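(* Let $\mathcal{G}^\sigma=\{\mathcal{V},\mathcal{E}^\sigma\}$ be the directed communication graph on $\mathcal{V}=\{1,\dots,N\}$ at a given value of the switching signal $\sigma$, with adjacency matrix $\mathcal{A}^\sigma=[\alpha_{ij}^\sigma]$ and set of pinning nodes $\mathcal{I}^\sigma\subseteq\mathcal{V}$, and let $\mathcal{B}^\sigma=[\beta_{ij}^\sigma]_{i,j=1}^N$ be the transformed adjacency matrix obtained by the network transformation mapping. Then the network corresponding to the adjacency matrix $\mathcal{B}^\sigma$ can be divided into two separated subgraphs $\mathcal{G}_\star^\sigma$ and $\mathcal{G}_\diamond^\sigma$ (no arc of the transformed network joins a node of one to a node of the other), where $\mathcal{G}_\star^\sigma$ contains exactly all the pinning nodes belonging to $\mathcal{I}^\sigma$ and their descendants in $\mathcal{G}^\sigma$, and $\mathcal{G}_\diamond^\sigma$ contains all the other nodes. Moreover, the transformation leaves the arcs of $\mathcal{G}^\sigma$ between pairs of nodes of $\mathcal{G}_\star^\sigma$ as they are, and removes all arcs of $\mathcal{G}^\sigma$ between pairs of nodes of $\mathcal{G}_\diamond^\sigma$ as well as all arcs (in either direction) between nodes of $\mathcal{G}_\star^\sigma$ and nodes of $\mathcal{G}_\diamond^\sigma$.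
   Context: Adjacency convention: $\alpha_{ij}^\sigma=1$ if there is an arc from $j$ to $i$ in $\mathcal{G}^\sigma$, and $\alpha_{ij}^\sigma=0$ otherwise. A node $i$ is a pinning node (at the given $\sigma$) if it has direct access to the leader's (reference signal's) state; $\mathcal{I}^\sigma$ is the set of pinning nodes. A descendant of a node $k$ is a node $i$ such that there is a directed path from $k$ to $i$. Network transformation mapping: for a node $i$ and a pinning node $k\in\mathcal{I}^\sigma$, let $\ell_{ik}^\sigma=1$ if there is a directed path in $\mathcal{G}^\sigma$ from $k$ to $i$ (the trivial path of length $0$ from a node to itself is allowed, so $\ell_{kk}^\sigma=1$ for $k\in\mathcal{I}^\sigma$), and $\ell_{ik}^\sigma=0$ otherwise. Put $\ell_i^\sigma=\bigvee_{k\in\mathcal{I}^\sigma}\ell_{ik}^\sigma$ (equal to $0$ if $\mathcal{I}^\sigma=\emptyset$), $\delta_{ij}^\sigma=\ell_i^\sigma\wedge\ell_j^\sigma$, and $\beta_{ij}^\sigma=\alpha_{ij}^\sigma\delta_{ij}^\sigma$, where $a\wedge b=\min\{a,b\}$ and $a\vee b=\max\{a,b\}$. *)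

theory Defs
  imports Complex_Main "Graph_Theory.Pair_Digraph" "Graph_Theory.Digraph_Component"
begin

text \<open>
  A digraph is a \<^typ>\<open>nat pair_pre_digraph\<close>; the pair \<open>(j, i)\<close> is the arc from
  \<open>j\<close> to \<open>i\<close>.  Matrices are functions of the row and the column index, and row \<open>i\<close>,
  column \<open>j\<close> describes the arc from \<open>j\<close> to \<open>i\<close> (transposed with respect to the pairs).
\<close>

definition adjacency :: "nat pair_pre_digraph \<Rightarrow> nat \<Rightarrow> nat \<Rightarrow> real" where
  "adjacency G i j = (if (j, i) \<in> parcs G then 1 else 0)"

definition network_of :: "nat set \<Rightarrow> (nat \<Rightarrow> nat \<Rightarrow> real) \<Rightarrow> nat pair_pre_digraph" where
  "network_of V B = \<lparr> pverts = V, parcs = {(j, i). j \<in> V \<and> i \<in> V \<and> B i j \<noteq> 0} \<rparr>"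

text \<open>The empty path is admitted, so every node of the graph has a path to itself.\<close>

definition has_dipath :: "nat pair_pre_digraph \<Rightarrow> nat \<Rightarrow> nat \<Rightarrow> bool" where
  "has_dipath G k i \<longleftrightarrow> (\<exists>p. pre_digraph.apath (with_proj G) k p i)"

definition descendants :: "nat pair_pre_digraph \<Rightarrow> nat \<Rightarrow> nat set" where
  "descendants G k = {i. has_dipath G k i}"

definition path_ind :: "nat pair_pre_digraph \<Rightarrow> nat \<Rightarrow> nat \<Rightarrow> real" where
  "path_ind G i k = (if has_dipath G k i then 1 else 0)"

definition pin_ind :: "nat pair_pre_digraph \<Rightarrow> nat set \<Rightarrow> nat \<Rightarrow> real" where
  "pin_ind G I i = (if I = {} then 0 else Max ((\<lambda>k. path_ind G i k) ` I))"

definition pin_delta :: "nat pair_pre_digraph \<Rightarrow> nat set \<Rightarrow> nat \<Rightarrow> nat \<Rightarrow> real" where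
  "pin_delta G I i j = min (pin_ind G I i) (pin_ind G I j)"

definition transformed_adjacency ::
    "nat pair_pre_digraph \<Rightarrow> nat set \<Rightarrow> nat \<Rightarrow> nat \<Rightarrow> real" where
  "transformed_adjacency G I i j = adjacency G i j * pin_delta G I i j"

definition transformed_network ::
    "nat pair_pre_digraph \<Rightarrow> nat set \<Rightarrow> nat pair_pre_digraph" where
  "transformed_network G I = network_of (pverts G) (transformed_adjacency G I)"

text \<open>Either part may be the null graph.\<close>

definition separated_division ::
    "nat pair_pre_digraph \<Rightarrow> nat pair_pre_digraph \<Rightarrow> nat pair_pre_digraph \<Rightarrow> bool" where
  "separated_division H H1 H2 \<longleftrightarrow>
     subgraph (with_proj H1) (with_proj H) \<and> subgraph (with_proj H2) (with_proj H) \<and>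
     pverts H1 \<inter> pverts H2 = {} \<and>
     pverts H = pverts H1 \<union> pverts H2 \<and> parcs H = parcs H1 \<union> parcs H2 \<and>
     (\<forall>u\<in>pverts H1. \<forall>v\<in>pverts H2. (u, v) \<notin> parcs H \<and> (v, u) \<notin> parcs H)"

lemma network_of_adjacency:
  assumes "pair_wf_digraph G"
  shows "network_of (pverts G) (adjacency G) = G"
  using pair_wf_digraph.in_arcsD1[OF assms] pair_wf_digraph.in_arcsD2[OF assms]
  by (intro pair_pre_digraph.equality) (auto simp: network_of_def adjacency_def)

lemma adjacency_transformed_network:
  assumes "pair_wf_digraph G" and "finite I"
  shows "adjacency (transformed_network G I) i j = transformed_adjacency G I i j"
proof -
  have pin: "pin_ind G I x \<in> {0, 1}" for x
  proof (cases "I = {}")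
    case False
    then have "Max ((\<lambda>k. path_ind G x k) ` I) \<in> (\<lambda>k. path_ind G x k) ` I"
      using assms(2) by (intro Max_in) auto
    then show ?thesis using False by (auto simp: pin_ind_def path_ind_def split: if_splits)
  qed (simp add: pin_ind_def)
  have "transformed_adjacency G I i j \<in> {0, 1}"
    using pin[of i] pin[of j]
    by (auto simp: transformed_adjacency_def adjacency_def pin_delta_def)
  then show ?thesis
    using pair_wf_digraph.in_arcsD1[OF assms(1), of j i]
      pair_wf_digraph.in_arcsD2[OF assms(1), of j i]
    by (auto simp: transformed_network_def network_of_def transformed_adjacency_def
        adjacency_def split: if_splits)
qed

end

theory Submission
  imports Defs
begin

text \<open>Let \<open>S\<close> be the set of nodes reachable from pinning nodes.
  \<open>pin_ind\<close> is the characteristic function of \<open>S\<close>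
  (\<open>pin_ind_eq\<close>), so \<open>pin_delta\<close>, a minimum of two of its values, is that
  of \<open>S \<times> S\<close>. Multiplying the adjacency matrix by it keeps exactly the arcs with
  both ends in \<open>S\<close> (\<open>parcs_transformed_network\<close>). All claims follow from
  this description: inside \<open>S\<close> nothing changes, and no arc touching the complement
  survives.\<close>

lemma has_dipath_refl:
  assumes "pair_wf_digraph G" and "k \<in> pverts G"
  shows "has_dipath G k k"
proof -
  interpret pair_wf_digraph G by (fact assms(1))
  show ?thesis
    using assms(2) unfolding has_dipath_def by (intro exI[of _ "[]"]) (simp add: apath_Nil_iff)
qed

lemma descendants_subset_pverts:
  assumes "pair_wf_digraph G"
  shows "descendants G k \<subseteq> pverts G"
proof -
  interpret pair_wf_digraph G by (fact assms)
  show ?thesis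
    unfolding descendants_def has_dipath_def by (auto intro: awalk_last_in_verts[OF awalkI_apath])
qed

text \<open>A maximum of finitely many zeros and ones is 1 exactly when one of them is 1. For empty
  \<open>I\<close> the default value 0 agrees with the empty union.\<close>

lemma pin_ind_eq:
  assumes "finite I"
  shows "pin_ind G I i = (if i \<in> (\<Union>k\<in>I. descendants G k) then 1 else 0)"
proof (cases "I = {}")
  case False
  have fin: "finite ((\<lambda>k. path_ind G i k) ` I)" and ne: "(\<lambda>k. path_ind G i k) ` I \<noteq> {}"
    using assms False by auto
  show ?thesis
  proof (cases "i \<in> (\<Union>k\<in>I. descendants G k)")
    case True
    then have "Max ((\<lambda>k. path_ind G i k) ` I) = 1"
      using fin by (intro Max_eqI) (auto simp: path_ind_def descendants_def)
    with True False show ?thesis by (simp add: pin_ind_def)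
  next
    case nd: False
    then have "(\<lambda>k. path_ind G i k) ` I = {0}"
      using False by (auto simp: path_ind_def descendants_def)
    with nd False show ?thesis by (simp add: pin_ind_def)
  qed
qed (simp add: pin_ind_def)

lemma parcs_transformed_network:
  assumes "pair_wf_digraph G" and "finite I"
  shows "parcs (transformed_network G I) =
    parcs G \<inter> (\<Union>k\<in>I. descendants G k) \<times> (\<Union>k\<in>I. descendants G k)"
proof (rule set_eqI, clarify)
  fix j i
  \<comment> \<open>\<open>network_of\<close> also asks both ends to be vertices; well-formedness of
    \<open>G\<close> supplies this for every arc.\<close>
  have "j \<in> pverts G \<and> i \<in> pverts G" if "(j, i) \<in> parcs G"
    using pair_wf_digraph.in_arcsD1[OF assms(1) that] pair_wf_digraph.in_arcsD2[OF assms(1) that]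
    by simp
  then show "(j, i) \<in> parcs (transformed_network G I) \<longleftrightarrow>
      (j, i) \<in> parcs G \<inter> (\<Union>k\<in>I. descendants G k) \<times> (\<Union>k\<in>I. descendants G k)"
    by (simp add: transformed_network_def network_of_def transformed_adjacency_def
        adjacency_def pin_delta_def pin_ind_eq[OF assms(2)] del: UN_iff)
qed

text \<open>Compatibility is automatic, since \<open>with_proj\<close> gives both digraphs the pair
  projections as tail and head maps.\<close>

lemma with_proj_subgraphI:
  assumes "pair_wf_digraph H'" and "pair_wf_digraph H"
    and "pverts H' \<subseteq> pverts H" and "parcs H' \<subseteq> parcs H"
  shows "subgraph (with_proj H') (with_proj H)"
  using assms by (simp add: subgraph_def compatible_def wf_digraph_wp_iff)

theorem lemma3:
  fixes N :: nat and G :: "nat pair_pre_digraph" and I :: "nat set"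
  assumes "pair_fin_digraph G" and "pverts G = {1..N}" and "I \<subseteq> {1..N}"
  shows "\<exists>Gstar Gdiam.
      separated_division (transformed_network G I) Gstar Gdiam \<and>
      pverts Gstar = I \<union> (\<Union>k\<in>I. descendants G k) \<and>
      pverts Gdiam = {1..N} - pverts Gstar \<and>
      (\<forall>u\<in>pverts Gstar. \<forall>v\<in>pverts Gstar.
        (u, v) \<in> parcs (transformed_network G I) \<longleftrightarrow> (u, v) \<in> parcs G) \<and>
      (\<forall>u\<in>pverts Gdiam. \<forall>v\<in>pverts Gdiam. (u, v) \<notin> parcs (transformed_network G I)) \<and>
      (\<forall>u\<in>pverts Gstar. \<forall>v\<in>pverts Gdiam.
        (u, v) \<notin> parcs (transformed_network G I) \<and>
        (v, u) \<notin> parcs (transformed_network G I))"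
proof -
  interpret pair_fin_digraph G by (fact assms(1))
  have wf: "pair_wf_digraph G" by unfold_locales
  define S where "S = (\<Union>k\<in>I. descendants G k)"
  define T where "T = transformed_network G I"
  \<comment> \<open>\<open>Gstar\<close> can take every arc of \<open>T\<close>, because all of them
    stay within \<open>S\<close>; none is left for \<open>Gdiam\<close>.\<close>
  define Gstar where "Gstar = \<lparr>pverts = S, parcs = parcs T\<rparr>"
  define Gdiam where "Gdiam = \<lparr>pverts = {1..N} - S, parcs = {}\<rparr>"
  have parcs_T: "parcs T = parcs G \<inter> S \<times> S"
    unfolding T_def S_def
    using parcs_transformed_network[OF wf] finite_subset[OF assms(3)] by simp
  have pverts_T: "pverts T = {1..N}"
    by (simp add: T_def transformed_network_def network_of_def assms(2))
  have S_sub: "S \<subseteq> {1..N}"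
    using descendants_subset_pverts[OF wf] assms(2) by (auto simp: S_def)
  \<comment> \<open>The trivial path makes each pinning node its own descendant, so the vertex set
    \<open>I \<union> S\<close> in the goal is just \<open>S\<close>.\<close>
  have I_sub: "I \<subseteq> S"
  proof
    fix k assume "k \<in> I"
    then have "has_dipath G k k"
      using has_dipath_refl[OF wf] assms(2,3) by blast
    with \<open>k \<in> I\<close> show "k \<in> S" by (auto simp: S_def descendants_def)
  qed
  have wf_T: "pair_wf_digraph T"
    using S_sub by unfold_locales (auto simp: parcs_T pverts_T)
  have "subgraph (with_proj Gstar) (with_proj T)"
    using S_sub by (intro with_proj_subgraphI wf_T, unfold_locales)
      (auto simp: Gstar_def parcs_T pverts_T)
  moreover have "subgraph (with_proj Gdiam) (with_proj T)"
    by (intro with_proj_subgraphI wf_T, unfold_locales) (auto simp: Gdiam_def pverts_T)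
  ultimately have "separated_division T Gstar Gdiam"
    using S_sub by (auto simp: separated_division_def Gstar_def Gdiam_def parcs_T pverts_T)
  moreover have "I \<union> S = S"
    using I_sub by blast
  ultimately show ?thesis
    unfolding T_def[symmetric] S_def[symmetric]
    by - (rule exI[of _ Gstar], rule exI[of _ Gdiam], auto simp: Gstar_def Gdiam_def parcs_T)
qed

end
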